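(* Let $R\in\mathbb{R}^{n\times n}$ be invertible. The max pairing $[\![x,y]\!]_{\infty,R}:=\max_{i\in I_\infty(Ry)}(Rx)_i(Ry)_i$ on $\mathbb{R}^n$ is a weak pairing compatible with the weighted $\ell_\infty$ norm $\|\cdot\|_{\infty,R}$.
   Context: $\|x\|_{\infty,R}=\|Rx\|_\infty$ and $I_\infty(v)=\{j\in\{1,\dots,n\}:|v_j|=\|v\|_\infty\}$. A weak pairing on $\mathbb{R}^n$ is a map $[\![\cdot,\cdot]\!]:\mathbb{R}^n\times\mathbb{R}^n\to\mathbb{R}$ such that: (1) $[\![x_1+x_2,y]\!]\le[\![x_1,y]\!]+[\![x_2,y]\!]$ for all $x_1,x_2,y$, and it is continuous in its first argument; (2) $[\![\alpha x,y]\!]=[\![x,\alpha y]\!]=\alpha[\![x,y]\!]$ for all $x,y$ and all $\alpha\ge 0$, and $[\![-x,-y]\!]=[\![x,y]\!]$; (3) $[\![x,x]\!]>0$ for all $x\ne 0_n$; (4) $|[\![x,y]\!]|\le[\![x,x]\!]^{1/2}[\![y,y]\!]^{1/2}$ for all $x,y$. It is compatible with a norm $\|\cdot\|$ if $[\![x,x]\!]=\|x\|^2$ for all $x$. *)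

theory Defs
  imports "HOL-Analysis.Analysis"
begin

definition weak_pairing :: "(real ^ 'n \<Rightarrow> real ^ 'n \<Rightarrow> real) \<Rightarrow> bool" where
  "weak_pairing W \<longleftrightarrow>
     (\<forall>x\<^sub>1 x\<^sub>2 y. W (x\<^sub>1 + x\<^sub>2) y \<le> W x\<^sub>1 y + W x\<^sub>2 y) \<and>
     (\<forall>y. continuous_on UNIV (\<lambda>x. W x y)) \<and>
     (\<forall>x y. \<forall>\<alpha>\<ge>0. W (\<alpha> *\<^sub>R x) y = \<alpha> * W x y \<and> W x (\<alpha> *\<^sub>R y) = \<alpha> * W x y) \<and>
     (\<forall>x y. W (- x) (- y) = W x y) \<and>
     (\<forall>x. x \<noteq> 0 \<longrightarrow> W x x > 0) \<and>
     (\<forall>x y. \<bar>W x y\<bar> \<le> sqrt (W x x) * sqrt (W y y))"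

(* The class constant norm on real ^ 'n is the Euclidean norm, so other norms
   are handled as functions satisfying the norm axioms. *)
definition is_norm :: "(real ^ 'n \<Rightarrow> real) \<Rightarrow> bool" where
  "is_norm N \<longleftrightarrow>
     (\<forall>x. N x \<ge> 0) \<and>
     (\<forall>x. N x = 0 \<longleftrightarrow> x = 0) \<and>
     (\<forall>c x. N (c *\<^sub>R x) = \<bar>c\<bar> * N x) \<and>
     (\<forall>x y. N (x + y) \<le> N x + N y)"

definition compatible_with_norm ::
    "(real ^ 'n \<Rightarrow> real ^ 'n \<Rightarrow> real) \<Rightarrow> (real ^ 'n \<Rightarrow> real) \<Rightarrow> bool" where
  "compatible_with_norm W N \<longleftrightarrow> is_norm N \<and> (\<forall>x. W x x = (N x)\<^sup>2)"

(* On real ^ 'n, infnorm is the l-infinity norm, the largest absolute value of a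
   component; see infnorm_cart. *)
definition weighted_infnorm :: "real ^ 'n ^ 'n \<Rightarrow> real ^ 'n \<Rightarrow> real" where
  "weighted_infnorm R x = infnorm (R *v x)"

definition I_inf :: "real ^ 'n \<Rightarrow> 'n set" where
  "I_inf v = {j. \<bar>v $ j\<bar> = infnorm v}"

definition max_pairing :: "real ^ 'n ^ 'n \<Rightarrow> real ^ 'n \<Rightarrow> real ^ 'n \<Rightarrow> real" where
  "max_pairing R x y = (MAX i\<in>I_inf (R *v y). (R *v x) $ i * (R *v y) $ i)"

end

theory Submission
  imports Defs
begin

text \<open>
  The pairing of \<open>x\<close> and \<open>y\<close> depends only on \<open>u = R x\<close> and \<open>v = R y\<close>: it is the maximum of the
  finitely many linear forms \<open>u \<mapsto> u $ i * v $ i\<close> over the nonempty set of indices \<open>i\<close> at which \<open>v\<close>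
  attains its \<open>\<ell>\<^sub>\<infinity>\<close> norm. A finite maximum of linear forms is subadditive, continuous and
  positively homogeneous. Scaling \<open>v\<close> by a nonzero factor does not change the index set, which
  gives homogeneity in the second argument for positive factors and invariance under a joint
  change of sign; for the factor \<open>0\<close> the index set may change, but then every form vanishes.

  On the index set \<open>\<bar>v $ i\<bar>\<close> equals the norm of \<open>v\<close>. Hence all forms take the value
  \<open>(infnorm v)\<^sup>2\<close> at \<open>u = v\<close>, which is compatibility with the norm, and every form is bounded by
  \<open>infnorm u * infnorm v\<close>, which then is the Cauchy--Schwarz inequality. Invertibility of \<open>R\<close>
  makes \<open>infnorm (R x)\<close> definite, and therefore a norm with a positive definite pairing.
\<close>

lemma I_inf_nonempty: "I_inf v \<noteq> {}"
proof -
  have "Max (range (\<lambda>i. \<bar>v $ i\<bar>)) \<in> range (\<lambda>i. \<bar>v $ i\<bar>)"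
    by (intro Max_in) auto
  then obtain i where i: "Max (range (\<lambda>i. \<bar>v $ i\<bar>)) = \<bar>v $ i\<bar>"
    by blast
  have "infnorm v = Max (range (\<lambda>i. \<bar>v $ i\<bar>))"
    by (simp add: infnorm_cart full_SetCompr_eq cSup_eq_Max)
  with i show ?thesis
    by (auto simp: I_inf_def)
qed

lemma I_inf_scaleR:
  assumes "c \<noteq> 0"
  shows "I_inf (c *\<^sub>R v) = I_inf v"
  using assms by (simp add: I_inf_def infnorm_mul abs_mult)

lemma max_pairing_ge:
  assumes "i \<in> I_inf (R *v y)"
  shows "(R *v x) $ i * (R *v y) $ i \<le> max_pairing R x y"
  unfolding max_pairing_def using assms by (intro Max_ge) auto

lemma max_pairing_attained:
  obtains i where "i \<in> I_inf (R *v y)" "max_pairing R x y = (R *v x) $ i * (R *v y) $ i"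
proof -
  have "max_pairing R x y \<in> (\<lambda>i. (R *v x) $ i * (R *v y) $ i) ` I_inf (R *v y)"
    unfolding max_pairing_def using I_inf_nonempty[of "R *v y"] by (intro Max_in) auto
  then show thesis
    using that by blast
qed

lemma max_pairing_subadditive:
  "max_pairing R (x + x') y \<le> max_pairing R x y + max_pairing R x' y"
proof -
  obtain i where i: "i \<in> I_inf (R *v y)"
    and "max_pairing R (x + x') y = (R *v (x + x')) $ i * (R *v y) $ i"
    by (rule max_pairing_attained)
  then show ?thesis
    using max_pairing_ge[OF i, of x] max_pairing_ge[OF i, of x']
    by (simp add: matrix_vector_right_distrib distrib_right)
qed

lemma continuous_on_Max:
  fixes f :: "'i \<Rightarrow> 'a::topological_space \<Rightarrow> 'b::linorder_topology"
  assumes "finite I" "I \<noteq> {}" "\<And>i. i \<in> I \<Longrightarrow> continuous_on S (f i)"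
  shows "continuous_on S (\<lambda>x. MAX i\<in>I. f i x)"
  using assms by (induction rule: finite_ne_induct) (simp_all add: continuous_on_max)

lemma continuous_on_max_pairing: "continuous_on S (\<lambda>x. max_pairing R x y)"
  unfolding max_pairing_def
  by (intro continuous_on_Max continuous_intros I_inf_nonempty finite
      matrix_vector_mult_linear_continuous_on)

text \<open>
  A factor \<open>c \<ge> 0\<close> common to all the forms can be taken out of a maximum over a fixed index set.
  This is the common core of scaling in the first argument, scaling by positive factors in the
  second, and the joint change of sign, where \<open>c = 1\<close>.
\<close>
lemma max_pairing_eq_multI:
  assumes "c \<ge> 0"
    and I: "I_inf (R *v y') = I_inf (R *v y)"
    and form: "\<And>i. (R *v x') $ i * (R *v y') $ i = c * ((R *v x) $ i * (R *v y) $ i)"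
  shows "max_pairing R x' y' = c * max_pairing R x y"
proof (rule antisym)
  obtain i where "i \<in> I_inf (R *v y')" "max_pairing R x' y' = (R *v x') $ i * (R *v y') $ i"
    by (rule max_pairing_attained)
  then show "max_pairing R x' y' \<le> c * max_pairing R x y"
    using I form \<open>c \<ge> 0\<close> by (simp add: max_pairing_ge mult_left_mono)
next
  obtain i where "i \<in> I_inf (R *v y)" "max_pairing R x y = (R *v x) $ i * (R *v y) $ i"
    by (rule max_pairing_attained)
  then show "c * max_pairing R x y \<le> max_pairing R x' y'"
    using I form max_pairing_ge[of i R y' x'] by simp
qed

lemma max_pairing_scaleR_left:
  assumes "c \<ge> 0"
  shows "max_pairing R (c *\<^sub>R x) y = c * max_pairing R x y"
  using assms by (intro max_pairing_eq_multI) (simp_all add: matrix_vector_mult_scaleR)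

lemma max_pairing_scaleR_right:
  assumes "c \<ge> 0"
  shows "max_pairing R x (c *\<^sub>R y) = c * max_pairing R x y"
proof (cases "c = 0")
  case True
  obtain i where "max_pairing R x 0 = (R *v x) $ i * (R *v 0) $ i"
    by (rule max_pairing_attained)
  with True show ?thesis
    by simp
next
  case False
  with assms show ?thesis
    by (intro max_pairing_eq_multI) (simp_all add: matrix_vector_mult_scaleR I_inf_scaleR)
qed

lemma max_pairing_minus: "max_pairing R (- x) (- y) = max_pairing R x y"
proof -
  have neg: "R *v (- z) = (- 1) *\<^sub>R (R *v z)" for z
    using matrix_vector_mult_scaleR[of R "- 1" z] by simp
  have "I_inf (R *v (- y)) = I_inf (R *v y)"
    unfolding neg by (rule I_inf_scaleR) simp
  then have "max_pairing R (- x) (- y) = 1 * max_pairing R x y"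
    by (intro max_pairing_eq_multI) (simp_all add: neg)
  then show ?thesis
    by simp
qed

lemma max_pairing_self: "max_pairing R x x = (weighted_infnorm R x)\<^sup>2"
proof -
  obtain i where "i \<in> I_inf (R *v x)" "max_pairing R x x = (R *v x) $ i * (R *v x) $ i"
    by (rule max_pairing_attained)
  then show ?thesis
    by (metis (mono_tags) I_inf_def mem_Collect_eq power2_abs power2_eq_square weighted_infnorm_def)
qed

lemma abs_max_pairing_le:
  "\<bar>max_pairing R x y\<bar> \<le> weighted_infnorm R x * weighted_infnorm R y"
proof -
  obtain i where "i \<in> I_inf (R *v y)" "max_pairing R x y = (R *v x) $ i * (R *v y) $ i"
    by (rule max_pairing_attained)
  then show ?thesis
    by (simp add: I_inf_def weighted_infnorm_def abs_mult mult_right_mono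
        component_le_infnorm_cart infnorm_pos_le)
qed

lemma weighted_infnorm_nonneg: "weighted_infnorm R x \<ge> 0"
  by (simp add: weighted_infnorm_def infnorm_pos_le)

lemma weighted_infnorm_eq_0_iff:
  assumes "invertible R"
  shows "weighted_infnorm R x = 0 \<longleftrightarrow> x = 0"
proof -
  have "R *v x = 0 \<longleftrightarrow> x = 0"
    using assms matrix_left_invertible_ker[of R] by (auto simp: invertible_def)
  then show ?thesis
    by (simp add: weighted_infnorm_def infnorm_eq_0)
qed

lemma is_norm_weighted_infnorm:
  assumes "invertible R"
  shows "is_norm (weighted_infnorm R)"
proof -
  have "weighted_infnorm R (c *\<^sub>R x) = \<bar>c\<bar> * weighted_infnorm R x" for c x
    by (simp add: weighted_infnorm_def matrix_vector_mult_scaleR infnorm_mul)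
  moreover have "weighted_infnorm R (x + y) \<le> weighted_infnorm R x + weighted_infnorm R y" for x y
    by (simp add: weighted_infnorm_def matrix_vector_right_distrib infnorm_triangle)
  ultimately show ?thesis
    by (simp add: is_norm_def weighted_infnorm_nonneg weighted_infnorm_eq_0_iff[OF assms])
qed

theorem lemma23:
  fixes R :: "real ^ 'n ^ 'n"
  assumes "invertible R"
  shows "weak_pairing (max_pairing R) \<and>
    compatible_with_norm (max_pairing R) (weighted_infnorm R)"
proof
  show "compatible_with_norm (max_pairing R) (weighted_infnorm R)"
    by (simp add: compatible_with_norm_def is_norm_weighted_infnorm[OF assms] max_pairing_self)
  have "max_pairing R x x > 0" if "x \<noteq> 0" for x
    using that by (simp add: max_pairing_self weighted_infnorm_eq_0_iff[OF assms])
  moreover have "sqrt (max_pairing R x x) = weighted_infnorm R x" for x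
    by (simp add: max_pairing_self weighted_infnorm_nonneg)
  ultimately show "weak_pairing (max_pairing R)"
    by (simp add: weak_pairing_def max_pairing_subadditive continuous_on_max_pairing
        max_pairing_scaleR_left max_pairing_scaleR_right max_pairing_minus abs_max_pairing_le)
qed

end
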